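(* Let $2<p<\infty$, and let $\Phi:[0,1)\to(1,\infty)$ be a differentiable increasing unbounded function such that $\frac{\Phi'(r)}{\Phi(r)}(1-r)$ is decreasing, $$\frac{\Phi(r)}{\left(\log\frac{e}{1-r}\right)^{\frac p2-1}}\to0,\quad r\to1^-,$$ and $$m=-\liminf_{r\to1^-}\frac{\Phi'(r)}{\Phi(r)}(1-r)\log\frac{e}{1-r}>1-\frac p2.$$ Then there exists a positive Borel measure $\mu$ on $\mathbb{D}$ such that $$\sup_{I\subset\mathbb{T}}\frac{\mu\left(S(I)\right)}{|I|\left(\log\frac{e}{|I|}\right)^{-p/2+1}\Phi(1-|I|)}<\infty,$$ where the supremum is over all arcs $I\subset\mathbb{T}$, but $\mu$ is not a $p$-Carleson measure for $\mathcal{D}^p_{p-1}$.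
   Context: $\mathbb{D}=\{z\in\mathbb{C}:|z|<1\}$, $\mathbb{T}=\partial\mathbb{D}$, and $dA(z)=\frac{dx\,dy}{\pi}$. The Dirichlet-type space $\mathcal{D}^p_{p-1}$ consists of analytic functions $f$ in $\mathbb{D}$ with $\|f\|_{\mathcal{D}^p_{p-1}}^p=\int_{\mathbb{D}}|f'(z)|^p(1-|z|^2)^{p-1}\,dA(z)+|f(0)|^p<\infty$. For an arc (interval) $I\subset\mathbb{T}$, $|I|$ is its normalized Lebesgue measure ($|\mathbb{T}|=1$), and the Carleson square is $S(I)=\{re^{it}:e^{it}\in I,\ 1-|I|\le r<1\}$. A positive Borel measure $\mu$ on $\mathbb{D}$ is a $p$-Carleson measure for $\mathcal{D}^p_{p-1}$ if the identity operator $\mathcal{D}^p_{p-1}\to L^p(\mu)$ is bounded, i.e. there is $C>0$ such that $\int_{\mathbb{D}}|f|^p\,d\mu\le C\|f\|_{\mathcal{D}^p_{p-1}}^p$ for all $f\in\mathcal{D}^p_{p-1}$. *)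

theory Defs
  imports "HOL-Complex_Analysis.Complex_Analysis"
begin

definition dA :: "complex measure" where
  "dA = scale_measure (ennreal (1 / pi)) lborel"

text \<open>The \<open>p\<close>-th power of the norm of \<open>D\<^sup>p\<^bsub>p-1\<^esub>\<close>, with value \<open>\<infinity>\<close> allowed.\<close>

definition dirichlet_norm_powr :: "real \<Rightarrow> (complex \<Rightarrow> complex) \<Rightarrow> ennreal" where
  "dirichlet_norm_powr p f =
     (\<integral>\<^sup>+ z \<in> ball 0 1. ennreal (norm (deriv f z) powr p * (1 - (norm z)\<^sup>2) powr (p - 1)) \<partial>dA)
     + ennreal (norm (f 0) powr p)"

definition dirichlet_space :: "real \<Rightarrow> (complex \<Rightarrow> complex) set" where
  "dirichlet_space p = {f. f holomorphic_on ball 0 1 \<and> dirichlet_norm_powr p f < \<infinity>}"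

text \<open>Arcs may contain either, both or none of their endpoints, and the full circle is an arc.
  Arcs of length zero are excluded by requiring the parameter interval to have interior points.\<close>

definition circle_arcs :: "complex set set" where
  "circle_arcs = {cis ` J | J. is_interval (J :: real set) \<and> interior J \<noteq> {}}"

definition arc_measure :: "complex set \<Rightarrow> real" where
  "arc_measure I = measure lebesgue {t \<in> {0..<2 * pi}. cis t \<in> I} / (2 * pi)"

definition carleson_square :: "complex set \<Rightarrow> complex set" where
  "carleson_square I =
     {of_real r * cis t | r t. cis t \<in> I \<and> 1 - arc_measure I \<le> r \<and> r < 1}"

definition borel_measure_on_disc :: "complex measure \<Rightarrow> bool" where
  "borel_measure_on_disc \<mu> \<longleftrightarrow> sets \<mu> = sets (restrict_space borel (ball 0 1))"

definition carleson_measure :: "real \<Rightarrow> complex measure \<Rightarrow> bool" where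
  "carleson_measure p \<mu> \<longleftrightarrow> borel_measure_on_disc \<mu> \<and>
     (\<exists>C::real. C > 0 \<and> (\<forall>f \<in> dirichlet_space p.
        (\<integral>\<^sup>+ z. ennreal (norm (f z) powr p) \<partial>\<mu>) \<le> ennreal C * dirichlet_norm_powr p f))"

end

theory Submission
  imports Defs "HOL-Real_Asymp.Real_Asymp"
begin

text \<open>
  Put \<open>L a = ln (e / a)\<close> and \<open>s = p/2 - 1\<close>. A rotation invariant measure that gives the annulus
  \<open>1 - h \<le> |z| < 1\<close> mass \<open>T h\<close> gives a Carleson square over an arc of length \<open>h\<close> mass \<open>h * T h\<close>.
  Such a measure can be \<open>p\<close>-Carleson only if \<open>T h \<lesssim> L h powr (- s)\<close>, so it is enough to let \<open>T h\<close>
  exceed this threshold by a factor that is unbounded but at most \<open>\<Phi> (1 - h)\<close>.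

  The necessity of the threshold is seen on the polynomials \<open>f\<^sub>N z = (\<Sum>k<N. z ^ 2 ^ k)\<close>. Since
  \<open>|f\<^sub>N' z|\<close> is at most \<open>2 / (1 - |z|)\<close> and at most \<open>2 ^ N\<close>, the Dirichlet integral of \<open>f\<^sub>N\<close>
  picks up a bounded amount from each of the first \<open>N\<close> dyadic annuli and a bounded amount from the
  rest of the disc, so that \<open>f\<^sub>N\<close> has \<open>p\<close>-th power norm \<open>O(N)\<close>
  (\<open>dirichlet_norm_powr_lacunary_poly_le\<close>). On circles of radius at least \<open>1 - 2 ^ (-N-1)\<close>, by
  orthogonality, the mean of \<open>|f\<^sub>N|\<^sup>2\<close> is comparable to \<open>N\<close>, hence the mean of \<open>|f\<^sub>N| powr p\<close> is at
  least a constant times \<open>N powr (p/2)\<close> (\<open>nn_integral_lacunary_poly_circle_ge\<close>). A \<open>p\<close>-Carleson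
  measure of the above kind therefore satisfies \<open>N powr (p/2) * T (2 ^ (-N-1)) \<lesssim> N\<close>.

  The measure is carried by the circles of radius \<open>1 - 2 ^ (-n-1)\<close>, and the circle number \<open>n\<close> has
  weight \<open>G n - G (Suc n)\<close>, so that the circles from number \<open>N\<close> on have total weight \<open>G N\<close>. Here
  \<open>G\<close> is the running minimum of \<open>g n = (n + 2) powr (- s) * \<Phi> (1 - 2 ^ (-n))\<close>. The decay of
  \<open>\<Phi> / L powr s\<close> gives \<open>g \<longlonglongrightarrow> 0\<close>, and \<open>G \<le> g\<close> gives the bound on Carleson squares. The sequence
  \<open>g n * (n + 2) powr s = \<Phi> (1 - 2 ^ (-n))\<close> tends to infinity because \<open>\<Phi>\<close> is increasing and
  unbounded, and passing to the running minimum preserves this (\<open>decreasing_minorant\<close>), in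
  contradiction to what a \<open>p\<close>-Carleson measure has to satisfy
  (\<open>not_carleson_measure_circles_measure\<close>).
\<close>

section \<open>Measures carried by concentric circles\<close>

text \<open>
  The factor on the angle is Lebesgue measure of total mass \<open>2 * pi\<close>, so the circle of radius
  \<open>\<rho> n\<close> carries mass \<open>2 * pi * w n\<close>. Writing the measure as the image of a product makes
  integration against it an instance of Tonelli's theorem.
\<close>

definition circles_measure :: "(nat \<Rightarrow> real) \<Rightarrow> (nat \<Rightarrow> real) \<Rightarrow> complex measure" where
  "circles_measure \<rho> w =
     distr (density (count_space UNIV) (\<lambda>n. ennreal (w n)) \<Otimes>\<^sub>M restrict_space lborel {0..<2 * pi})
       (restrict_space borel (ball 0 1)) (\<lambda>(n, t). of_real (\<rho> n) * cis t)"

lemma borel_measure_on_disc_circles_measure: "borel_measure_on_disc (circles_measure \<rho> w)"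
  by (simp add: borel_measure_on_disc_def circles_measure_def)

lemma nn_integral_circles_measure:
  fixes F :: "complex \<Rightarrow> ennreal"
  assumes \<rho>: "\<And>n. 0 < \<rho> n" "\<And>n. \<rho> n < 1"
    and F: "F \<in> borel_measurable (restrict_space borel (ball 0 1))"
  shows "(\<integral>\<^sup>+ z. F z \<partial>circles_measure \<rho> w) =
    (\<Sum>n. ennreal (w n) * (\<integral>\<^sup>+ t \<in> {0..<2 * pi}. F (of_real (\<rho> n) * cis t) \<partial>lborel))"
proof -
  let ?W = "density (count_space UNIV) (\<lambda>n. ennreal (w n))"
  let ?T = "restrict_space lborel {0..<2 * pi :: real}"
  interpret sigma_finite_measure ?T
    by (rule sigma_finite_measure_restrict_space[OF sigma_finite_lborel]) simp
  have m: "(\<lambda>(n, t). of_real (\<rho> n) * cis t)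
      \<in> measurable (?W \<Otimes>\<^sub>M ?T) (restrict_space borel (ball 0 1))"
  proof (rule measurable_restrict_space2)
    show "(\<lambda>(n, t). of_real (\<rho> n) * cis t) \<in> space (?W \<Otimes>\<^sub>M ?T) \<rightarrow> ball 0 1"
      using \<rho> by (auto simp: norm_mult abs_of_pos)
    have "(\<lambda>x :: nat \<times> real. case x of (n, t) \<Rightarrow> of_real (\<rho> n) * cis t)
        \<in> borel_measurable (count_space UNIV \<Otimes>\<^sub>M ?T)"
    proof (rule measurable_pair_measure_countable1)
      fix n :: nat
      have "(\<lambda>t. of_real (\<rho> n) * cis t) \<in> borel_measurable borel"
        by (intro borel_measurable_continuous_onI continuous_intros)
      thus "(\<lambda>y. case (n, y) of (n, t) \<Rightarrow> of_real (\<rho> n) * cis t) \<in> borel_measurable ?T"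
        by (simp add: measurable_restrict_space1)
    qed simp
    also have "borel_measurable (count_space UNIV \<Otimes>\<^sub>M ?T) = borel_measurable (?W \<Otimes>\<^sub>M ?T)"
      by (intro measurable_cong_sets sets_pair_measure_cong) auto
    finally show "(\<lambda>(n, t). of_real (\<rho> n) * cis t) \<in> borel_measurable (?W \<Otimes>\<^sub>M ?T)" .
  qed
  have mF: "(\<lambda>x. F (case x of (n, t) \<Rightarrow> of_real (\<rho> n) * cis t)) \<in> borel_measurable (?W \<Otimes>\<^sub>M ?T)"
    using measurable_compose[OF m F] by simp
  have "(\<integral>\<^sup>+ z. F z \<partial>circles_measure \<rho> w) =
      (\<integral>\<^sup>+ x. F (case x of (n, t) \<Rightarrow> of_real (\<rho> n) * cis t) \<partial>(?W \<Otimes>\<^sub>M ?T))"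
    unfolding circles_measure_def using F by (subst nn_integral_distr[OF m]) simp_all
  also have "\<dots> = (\<integral>\<^sup>+ n. \<integral>\<^sup>+ t. F (of_real (\<rho> n) * cis t) \<partial>?T \<partial>?W)"
    by (subst nn_integral_fst[OF mF, symmetric]) simp
  also have "\<dots> = (\<Sum>n. ennreal (w n) * (\<integral>\<^sup>+ t. F (of_real (\<rho> n) * cis t) \<partial>?T))"
    by (subst nn_integral_density) (auto simp: nn_integral_count_space_nat)
  finally show ?thesis
    by (simp add: nn_integral_restrict_space)
qed

lemma arc_measure_le_1: "arc_measure I \<le> 1"
proof -
  define T where "T = {t \<in> {0..<2 * pi}. cis t \<in> I}"
  have "measure lebesgue T \<le> 2 * pi"
  proof (cases "T \<in> sets lebesgue")
    case True
    have "measure lebesgue T \<le> measure lebesgue {0..2 * pi}"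
      by (rule measure_mono_fmeasurable) (use True in \<open>auto simp: T_def\<close>)
    thus ?thesis by simp
  qed (simp add: measure_notin_sets)
  thus ?thesis by (simp add: arc_measure_def T_def)
qed

text \<open>
  Each of the circles that meets the square meets it in a copy of \<open>I\<close>. As for measurability, a
  square that is not a Borel set has \<open>emeasure\<close> equal to \<open>0\<close> by convention, whereas for a Borel
  square the parameter set of \<open>I\<close> is Borel as the preimage of the square under the
  parametrisation of any of the circles that meet it.
\<close>

lemma emeasure_circles_measure_carleson_square_le:
  assumes \<rho>: "\<And>n. 0 < \<rho> n" "\<And>n. \<rho> n < 1"
  shows "emeasure (circles_measure \<rho> w) (carleson_square I)
    \<le> (\<Sum>n. ennreal (w n) * indicator {n. 1 - arc_measure I \<le> \<rho> n} n)
        * ennreal (2 * pi * arc_measure I)"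
proof (cases "carleson_square I \<in> sets (circles_measure \<rho> w)")
  case False
  then show ?thesis by (simp add: emeasure_notin_sets)
next
  case True
  define S where "S = carleson_square I"
  have sets: "S \<in> sets (restrict_space borel (ball 0 1))"
    using True by (simp add: S_def circles_measure_def)
  define T where "T = {t \<in> {0..<2 * pi}. cis t \<in> I}"
  have arc: "arc_measure I = measure lebesgue T / (2 * pi)"
    by (simp add: arc_measure_def T_def)
  have mem: "of_real (\<rho> n) * cis t \<in> S \<longleftrightarrow> cis t \<in> I \<and> 1 - arc_measure I \<le> \<rho> n" for n t
  proof
    assume "of_real (\<rho> n) * cis t \<in> S"
    then obtain r s where rs: "of_real (\<rho> n) * cis t = of_real r * cis s"
      "cis s \<in> I" "1 - arc_measure I \<le> r" "r < 1"
      by (auto simp: S_def carleson_square_def)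
    hence "r \<ge> 0" using arc_measure_le_1[of I] by simp
    moreover have "norm (of_real (\<rho> n) * cis t) = norm (of_real r * cis s)" using rs by simp
    ultimately have "r = \<rho> n" using \<rho>(1)[of n] by (simp add: norm_mult)
    then show "cis t \<in> I \<and> 1 - arc_measure I \<le> \<rho> n" using rs \<rho>(1)[of n] by auto
  qed (use \<rho> in \<open>auto simp: S_def carleson_square_def\<close>)
  have "emeasure (circles_measure \<rho> w) S = (\<integral>\<^sup>+ z. indicator S z \<partial>circles_measure \<rho> w)"
    using True by (simp add: S_def)
  also have "\<dots> = (\<Sum>n. ennreal (w n) *
      (\<integral>\<^sup>+ t \<in> {0..<2 * pi}. indicator S (of_real (\<rho> n) * cis t) \<partial>lborel))"
    using sets by (intro nn_integral_circles_measure \<rho>) simp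
  also have "\<dots> \<le> (\<Sum>n. ennreal (w n) * indicator {n. 1 - arc_measure I \<le> \<rho> n} n
        * ennreal (2 * pi * arc_measure I))"
  proof (intro suminf_le allI)
    fix n
    have "(\<integral>\<^sup>+ t \<in> {0..<2 * pi}. indicator S (of_real (\<rho> n) * cis t) \<partial>lborel)
       \<le> indicator {n. 1 - arc_measure I \<le> \<rho> n} n * ennreal (2 * pi * arc_measure I)"
    proof (cases "1 - arc_measure I \<le> \<rho> n")
      case True
      have "T = {0..<2 * pi} \<inter> (\<lambda>t. of_real (\<rho> n) * cis t) -` S"
        using True by (auto simp: T_def mem)
      moreover have "S \<in> sets borel"
        using sets by (subst (asm) sets_restrict_space_iff) auto
      moreover have "(\<lambda>t. of_real (\<rho> n) * cis t) \<in> borel_measurable borel"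
        by (intro borel_measurable_continuous_onI continuous_intros)
      ultimately have T: "T \<in> sets borel"
        using measurable_sets_borel by auto
      have "emeasure lborel T \<le> emeasure lborel {0..2 * pi}"
        by (rule emeasure_mono) (auto simp: T_def)
      hence "emeasure lborel T \<noteq> \<infinity>" by (auto simp: top_unique)
      hence "emeasure lborel T = ennreal (2 * pi * arc_measure I)"
        using T arc by (subst emeasure_eq_ennreal_measure) (auto simp: measure_completion)
      moreover have "(\<integral>\<^sup>+ t \<in> {0..<2 * pi}. indicator S (of_real (\<rho> n) * cis t) \<partial>lborel)
          = (\<integral>\<^sup>+ t. indicator T t \<partial>lborel)"
        using True by (intro nn_integral_cong) (auto simp: T_def mem split: split_indicator)
      ultimately show ?thesis using T True by simp
    next
      case False
      hence "indicator S (of_real (\<rho> n) * cis t) = (0 :: ennreal)" for t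
        by (simp add: mem)
      thus ?thesis by simp
    qed
    thus "ennreal (w n) *
        (\<integral>\<^sup>+ t \<in> {0..<2 * pi}. indicator S (of_real (\<rho> n) * cis t) \<partial>lborel)
       \<le> ennreal (w n) * indicator {n. 1 - arc_measure I \<le> \<rho> n} n
          * ennreal (2 * pi * arc_measure I)"
      by (simp add: mult_left_mono mult.assoc)
  qed auto
  finally show ?thesis by (simp add: S_def)
qed

section \<open>Weights with prescribed tails\<close>

lemma tail_weights_suminf:
  fixes G :: "nat \<Rightarrow> real"
  assumes "decseq G" "G \<longlonglongrightarrow> 0"
  shows "(\<Sum>n. ennreal (G n - G (Suc n)) * indicator {N..} n) = ennreal (G N)"
proof -
  have w: "G n - G (Suc n) \<ge> 0" for n using decseqD[OF assms(1), of n "Suc n"] by simp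
  have "(\<lambda>n. G (n + N) - G (Suc n + N)) sums (G (0 + N) - 0)"
    by (intro telescope_sums'[of "\<lambda>n. G (n + N)"] LIMSEQ_ignore_initial_segment assms)
  hence "(\<lambda>n. (G n - G (Suc n)) * indicator {N..} n) sums G N"
    by (subst sums_zero_iff_shift[of N, symmetric]) auto
  hence "(\<Sum>n. ennreal ((G n - G (Suc n)) * indicator {N..} n)) = ennreal (G N)"
    using w by (intro suminf_ennreal_eq) auto
  thus ?thesis using w by (simp add: ennreal_mult ennreal_indicator)
qed

text \<open>
  The running minimum \<open>G n\<close> is a value \<open>g k\<close> with \<open>k \<le> n\<close>. If \<open>k\<close> is large then
  \<open>G n * b n \<ge> g k * b k\<close> is large because \<open>b\<close> increases; if \<open>k\<close> stays below some \<open>M\<close> then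
  \<open>G n\<close> stays above the fixed number \<open>G M\<close> and \<open>b n\<close> alone makes the product large.
\<close>

lemma decreasing_minorant:
  fixes g b :: "nat \<Rightarrow> real"
  assumes g: "\<And>n. 0 < g n" "g \<longlonglongrightarrow> 0"
    and b: "incseq b" "filterlim b at_top sequentially" "\<And>n. 0 < b n"
    and gb: "filterlim (\<lambda>n. g n * b n) at_top sequentially"
  obtains G where "decseq G" "\<And>n. 0 < G n" "\<And>n. G n \<le> g n" "G \<longlonglongrightarrow> 0"
    "filterlim (\<lambda>n. G n * b n) at_top sequentially"
proof
  define G where "G n = Min (g ` {..n})" for n
  have att: "\<exists>k\<le>n. G n = g k" for n
  proof -
    have "G n \<in> g ` {..n}" unfolding G_def by (rule Min_in) auto
    thus ?thesis by auto
  qed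
  show le: "G n \<le> g n" for n by (simp add: G_def)
  show dec: "decseq G"
    unfolding decseq_def G_def by (auto intro!: Min_antimono)
  show pos: "0 < G n" for n using att[of n] g by auto
  show "G \<longlonglongrightarrow> 0"
    by (rule tendsto_sandwich[OF _ _ tendsto_const g(2)]) (use pos le in \<open>auto intro: less_imp_le always_eventually\<close>)
  show "filterlim (\<lambda>n. G n * b n) at_top sequentially"
    unfolding filterlim_at_top
  proof
    fix Z :: real
    from gb obtain M where M: "\<And>n. n \<ge> M \<Longrightarrow> Z \<le> g n * b n"
      by (auto simp: filterlim_at_top eventually_sequentially)
    from b(2) obtain M' where M': "\<And>n. n \<ge> M' \<Longrightarrow> Z / G M \<le> b n"
      by (auto simp: filterlim_at_top eventually_sequentially)
    have "Z \<le> G n * b n" if "n \<ge> max M M'" for n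
    proof -
      obtain k where k: "k \<le> n" "G n = g k" using att by blast
      show ?thesis
      proof (cases "k \<ge> M")
        case True
        have "Z \<le> g k * b k" using M True by simp
        also have "\<dots> \<le> g k * b n" using k b(1) g(1)[of k] by (simp add: incseq_def)
        finally show ?thesis using k by simp
      next
        case False
        hence "G M \<le> g k" by (auto simp: G_def)
        have "Z \<le> G M * b n" using M'[of n] that pos[of M] by (simp add: field_simps)
        also have "\<dots> \<le> g k * b n" using \<open>G M \<le> g k\<close> b(3)[of n] by (simp add: mult_right_mono)
        finally show ?thesis using k by simp
      qed
    qed
    thus "eventually (\<lambda>n. Z \<le> G n * b n) sequentially"
      unfolding eventually_sequentially by blast
  qed
qed

section \<open>Lacunary polynomials: the Dirichlet norm\<close>

definition lacunary_poly :: "nat \<Rightarrow> complex \<Rightarrow> complex" where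
  "lacunary_poly N z = (\<Sum>k<N. z ^ 2 ^ k)"

lemma lacunary_poly_0 [simp]: "lacunary_poly N 0 = 0"
  by (simp add: lacunary_poly_def zero_power)

lemma lacunary_poly_holomorphic: "lacunary_poly N holomorphic_on A"
  unfolding lacunary_poly_def by (intro holomorphic_intros)

lemma deriv_lacunary_poly: "deriv (lacunary_poly N) z = (\<Sum>k<N. 2 ^ k * z ^ (2 ^ k - 1))"
  unfolding lacunary_poly_def
  by (rule DERIV_imp_deriv) (auto intro!: derivative_eq_intros sum.cong)

lemma norm_deriv_lacunary_poly_le_power:
  assumes "norm z \<le> 1"
  shows "norm (deriv (lacunary_poly N) z) \<le> 2 ^ N"
proof -
  have "norm (deriv (lacunary_poly N) z) \<le> (\<Sum>k<N. norm (2 ^ k * z ^ (2 ^ k - 1)))"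
    unfolding deriv_lacunary_poly by (rule norm_sum)
  also have "\<dots> \<le> (\<Sum>k<N. 2 ^ k)"
    using assms by (intro sum_mono) (simp add: norm_mult norm_power power_le_one)
  also have "\<dots> \<le> 2 ^ N"
    using sum_power2[of N] by (induction N) auto
  finally show ?thesis .
qed

text \<open>
  The term with index \<open>k + 1\<close> is at most twice the block \<open>2 ^ k \<le> j < 2 ^ (k + 1)\<close> of the geometric
  series, which has \<open>2 ^ k\<close> terms, each at least \<open>r ^ (2 ^ (k + 1) - 1)\<close>.
\<close>

lemma sum_dyadic_le_geometric:
  fixes r :: real
  assumes "0 \<le> r" "r \<le> 1"
  shows "(\<Sum>k<Suc N. 2 ^ k * r ^ (2 ^ k - 1)) \<le> 2 * (\<Sum>j<2 ^ N. r ^ j)"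
proof (induction N)
  case (Suc N)
  have "(\<Sum>j\<in>{2 ^ N..<2 ^ Suc N :: nat}. r ^ (2 ^ Suc N - 1)) \<le> (\<Sum>j\<in>{2 ^ N..<2 ^ Suc N :: nat}. r ^ j)"
    using assms by (intro sum_mono power_decreasing) auto
  hence "2 ^ Suc N * r ^ (2 ^ Suc N - 1) \<le> 2 * (\<Sum>j\<in>{2 ^ N..<2 ^ Suc N :: nat}. r ^ j)"
    by (simp add: of_nat_diff)
  moreover have "(\<Sum>j<2 ^ Suc N. r ^ j) = (\<Sum>j<2 ^ N. r ^ j) + (\<Sum>j\<in>{2 ^ N..<2 ^ Suc N :: nat}. r ^ j)"
    using sum.atLeastLessThan_concat[of 0 "2 ^ N :: nat" "2 ^ Suc N" "\<lambda>j. r ^ j"]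
    by (simp add: lessThan_atLeast0)
  ultimately show ?case using Suc.IH by (subst sum.lessThan_Suc) (simp only: distrib_left)
qed simp

lemma norm_deriv_lacunary_poly_le_inverse:
  assumes "norm z < 1"
  shows "norm (deriv (lacunary_poly N) z) \<le> 2 / (1 - norm z)"
proof -
  have "norm (deriv (lacunary_poly N) z) \<le> (\<Sum>k<N. norm (2 ^ k * z ^ (2 ^ k - 1)))"
    unfolding deriv_lacunary_poly by (rule norm_sum)
  also have "\<dots> \<le> (\<Sum>k<Suc N. 2 ^ k * norm z ^ (2 ^ k - 1))"
    by (simp add: norm_mult norm_power)
  also have "\<dots> \<le> 2 * (\<Sum>j<2 ^ N. norm z ^ j)"
    using assms by (intro sum_dyadic_le_geometric) auto
  also have "\<dots> \<le> 2 * (1 / (1 - norm z))"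
    using assms by (intro mult_left_mono) (auto simp: sum_gp_strict divide_simps)
  finally show ?thesis by simp
qed

lemma dA_boundary_annulus_le:
  assumes "0 \<le> h" "h \<le> 1"
  shows "emeasure dA (ball 0 1 - ball 0 (1 - h)) \<le> ennreal (2 * h)"
proof -
  have "emeasure lborel (ball 0 1 - ball 0 (1 - h) :: complex set)
      = emeasure lborel (ball 0 1 :: complex set) - emeasure lborel (ball 0 (1 - h) :: complex set)"
    using assms by (intro emeasure_Diff) (auto simp: emeasure_ball intro!: subset_ball)
  also have "\<dots> = ennreal (pi - pi * (1 - h)\<^sup>2)"
    using assms by (simp add: emeasure_ball unit_ball_vol_2 ennreal_minus)
  finally have "emeasure dA (ball 0 1 - ball 0 (1 - h)) = ennreal (1 / pi) * ennreal (pi - pi * (1 - h)\<^sup>2)"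
    by (simp add: dA_def)
  also have "\<dots> = ennreal (1 - (1 - h)\<^sup>2)"
    by (subst ennreal_mult[symmetric])
       (use assms in \<open>auto simp: field_simps power_le_one intro!: mult_left_le\<close>)
  also have "\<dots> \<le> ennreal (2 * h)"
    using assms by (intro ennreal_leI) (auto simp: power2_eq_square algebra_simps)
  finally show ?thesis .
qed

text \<open>
  The annuli \<open>1 - 2 ^ (-n) \<le> |z| < 1\<close> are nested, and the integrand at \<open>z\<close> is dominated by the single
  term of the last one, \<open>n \<le> N\<close>, that contains \<open>z\<close>. The bound is made for integration: the area of
  the \<open>n\<close>-th annulus is of order \<open>2 ^ (-n)\<close>, so every term contributes a bounded amount.
\<close>

lemma dirichlet_integrand_lacunary_poly_le:
  fixes p :: real and z :: complex
  assumes p: "1 < p" and z: "norm z < 1"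
  shows "norm (deriv (lacunary_poly N) z) powr p * (1 - (norm z)\<^sup>2) powr (p - 1)
    \<le> (\<Sum>n\<le>N. 2 powr (3 * p) * 2 ^ n * indicator (ball 0 1 - ball 0 (1 - (1/2) ^ n)) z)"
proof -
  let ?A = "\<lambda>n. ball 0 1 - ball 0 (1 - (1/2) ^ n) :: complex set"
  let ?F = "norm (deriv (lacunary_poly N) z) powr p * (1 - (norm z)\<^sup>2) powr (p - 1)"
  define n where "n = (GREATEST n. n \<le> N \<and> z \<in> ?A n)"
  have "n \<le> N \<and> z \<in> ?A n"
    unfolding n_def by (rule GreatestI_nat[of _ 0 N]) (use z in auto)
  hence n: "n \<le> N" "1 - (1/2) ^ n \<le> norm z" by auto
  \<comment> \<open>For \<open>n < N\<close> the point lies outside the next annulus, which bounds \<open>1 - |z|\<close> from below.\<close>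
  have up: "norm (deriv (lacunary_poly N) z) \<le> 2 ^ (n + 2)"
  proof (cases "n = N")
    case True
    have "norm (deriv (lacunary_poly N) z) \<le> 2 ^ N"
      by (rule norm_deriv_lacunary_poly_le_power) (use z in auto)
    also have "\<dots> \<le> 2 ^ (n + 2)" using True by simp
    finally show ?thesis .
  next
    case False
    have "\<not> (Suc n \<le> N \<and> z \<in> ?A (Suc n))"
      using Greatest_le_nat[of "\<lambda>n. n \<le> N \<and> z \<in> ?A n" "Suc n" N] unfolding n_def[symmetric] by auto
    hence "(1/2) ^ Suc n < 1 - norm z" using False n z by auto
    hence "2 / (1 - norm z) \<le> 2 / (1/2) ^ Suc n"
      using z by (intro divide_left_mono) auto
    with norm_deriv_lacunary_poly_le_inverse[OF z, of N] show ?thesis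
      by (simp add: power_one_over field_simps)
  qed
  have "1 - (norm z)\<^sup>2 = (1 - norm z) * (1 + norm z)" by (simp add: power2_eq_square algebra_simps)
  also have "\<dots> \<le> (1/2) ^ n * 2" using n z by (intro mult_mono) auto
  finally have low: "1 - (norm z)\<^sup>2 \<le> 2 * (1/2) ^ n" by simp
  have "(norm z)\<^sup>2 \<le> 1" using z by (simp add: power_le_one)
  hence "?F \<le> (2 ^ (n + 2)) powr p * (2 * (1/2) ^ n) powr (p - 1)"
    using up low p by (intro mult_mono powr_mono2) auto
  also have "\<dots> = 2 powr ((real n + 2) * p + (1 - real n) * (p - 1))"
  proof -
    have "(2 :: real) ^ (n + 2) = 2 powr (real n + 2)"
      by (simp add: powr_add powr_realpow)
    moreover have "2 * (1/2 :: real) ^ n = 2 powr (1 - real n)"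
      by (simp add: powr_diff powr_realpow power_one_over)
    ultimately show ?thesis by (simp only: powr_powr flip: powr_add)
  qed
  also have "\<dots> \<le> 2 powr (3 * p + n)"
    by (intro powr_mono) (auto simp: algebra_simps)
  also have "\<dots> = 2 powr (3 * p) * 2 ^ n * indicator (?A n) z"
    using n z by (simp add: powr_add powr_realpow)
  also have "\<dots> \<le> (\<Sum>n\<le>N. 2 powr (3 * p) * 2 ^ n * indicator (?A n) z)"
    by (rule member_le_sum[where f = "\<lambda>n. 2 powr (3 * p) * 2 ^ n * indicator (?A n) z"])
       (use n in auto)
  finally show ?thesis .
qed

lemma dirichlet_norm_powr_lacunary_poly_le:
  fixes p :: real
  assumes p: "1 < p"
  shows "dirichlet_norm_powr p (lacunary_poly N) \<le> ennreal (2 * 2 powr (3 * p) * (N + 1))"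
proof -
  let ?A = "\<lambda>n. ball 0 1 - ball 0 (1 - (1/2) ^ n) :: complex set"
  let ?K = "2 powr (3 * p)"
  have sets: "?A n \<in> sets dA" for n by (simp add: dA_def)
  have "dirichlet_norm_powr p (lacunary_poly N) = (\<integral>\<^sup>+ z \<in> ball 0 1.
      ennreal (norm (deriv (lacunary_poly N) z) powr p * (1 - (norm z)\<^sup>2) powr (p - 1)) \<partial>dA)"
    by (simp add: dirichlet_norm_powr_def)
  also have "\<dots> \<le> (\<integral>\<^sup>+ z. (\<Sum>n\<le>N. ennreal (?K * 2 ^ n) * indicator (?A n) z) \<partial>dA)"
  proof (intro nn_integral_mono)
    fix z :: complex
    show "ennreal (norm (deriv (lacunary_poly N) z) powr p * (1 - (norm z)\<^sup>2) powr (p - 1))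
        * indicator (ball 0 1) z \<le> (\<Sum>n\<le>N. ennreal (?K * 2 ^ n) * indicator (?A n) z)"
    proof (cases "norm z < 1")
      case True
      have "(\<Sum>n\<le>N. ennreal (?K * 2 ^ n) * indicator (?A n) z)
          = ennreal (\<Sum>n\<le>N. ?K * 2 ^ n * indicator (?A n) z)"
        by (subst sum_ennreal[symmetric]) (auto simp: ennreal_mult ennreal_indicator)
      with dirichlet_integrand_lacunary_poly_le[OF p True, of N] True show ?thesis
        by (simp add: ennreal_leI)
    qed simp
  qed
  also have "\<dots> = (\<Sum>n\<le>N. ennreal (?K * 2 ^ n) * emeasure dA (?A n))"
    using sets by (subst nn_integral_sum)
      (auto simp: nn_integral_cmult_indicator simp del: sum_ennreal intro!: borel_measurable_times_ennreal)
  also have "\<dots> \<le> (\<Sum>n\<le>N. ennreal (?K * 2 ^ n) * ennreal (2 * (1/2) ^ n))"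
    by (intro sum_mono mult_left_mono dA_boundary_annulus_le) (auto simp: power_le_one)
  also have "\<dots> = (\<Sum>n\<le>N. ennreal (2 * ?K))"
    by (intro sum.cong) (auto simp: ennreal_mult[symmetric] power_one_over)
  also have "\<dots> = ennreal (2 * ?K * (N + 1))"
    by (simp add: ennreal_of_nat_eq_real_of_nat ennreal_mult[symmetric] algebra_simps flip: of_nat_Suc)
  finally show ?thesis .
qed

section \<open>Lacunary polynomials: integral means on circles\<close>

lemma has_integral_cos_int:
  "((\<lambda>t. cos (of_int m * t)) has_integral (if m = 0 then 2 * pi else 0)) {0..2 * pi}"
proof (cases "m = 0")
  case True
  then show ?thesis using has_integral_const_real[of "1::real" 0 "2 * pi"] by simp
next
  case False
  have "((\<lambda>t. cos (of_int m * t)) has_integral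
      sin (of_int m * (2 * pi)) / of_int m - sin (of_int m * 0) / of_int m) {0..2 * pi}"
    using False
    by (intro fundamental_theorem_of_calculus)
       (auto intro!: derivative_eq_intros simp: has_real_derivative_iff_has_vector_derivative[symmetric])
  moreover have "sin (of_int m * (2 * pi)) = 0"
    using sin_int_2pin[of m] by (simp add: mult_ac)
  ultimately show ?thesis using False by simp
qed

lemma norm_sq_lacunary_poly:
  "(norm (lacunary_poly N (of_real r * cis t)))\<^sup>2 =
     (\<Sum>j<N. \<Sum>k<N. r ^ 2 ^ j * r ^ 2 ^ k * cos (of_int (2 ^ j - 2 ^ k) * t))"
proof -
  have "lacunary_poly N (of_real r * cis t) =
      (\<Sum>k<N. of_real (r ^ 2 ^ k) * cis (2 ^ k * t))"
    unfolding lacunary_poly_def power_mult_distrib Complex.DeMoivre by simp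
  hence "(norm (lacunary_poly N (of_real r * cis t)))\<^sup>2 =
      (\<Sum>k<N. r ^ 2 ^ k * cos (2 ^ k * t))\<^sup>2 + (\<Sum>k<N. r ^ 2 ^ k * sin (2 ^ k * t))\<^sup>2"
    by (simp add: cmod_power2)
  also have "\<dots> = (\<Sum>j<N. \<Sum>k<N. r ^ 2 ^ j * r ^ 2 ^ k *
      (cos (2 ^ j * t) * cos (2 ^ k * t) + sin (2 ^ j * t) * sin (2 ^ k * t)))"
    unfolding power2_eq_square sum_product sum.distrib[symmetric]
    by (intro sum.cong refl) (simp add: algebra_simps)
  finally show ?thesis by (simp add: cos_diff left_diff_distrib)
qed

lemma has_integral_norm_sq_lacunary_poly:
  "((\<lambda>t. (norm (lacunary_poly N (of_real r * cis t)))\<^sup>2) has_integral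
     2 * pi * (\<Sum>k<N. (r ^ 2 ^ k)\<^sup>2)) {0..2 * pi}"
proof -
  have "((\<lambda>t. \<Sum>j<N. \<Sum>k<N. r ^ 2 ^ j * r ^ 2 ^ k * cos (of_int (2 ^ j - 2 ^ k) * t)) has_integral
     (\<Sum>j<N. \<Sum>k<N. r ^ 2 ^ j * r ^ 2 ^ k * (if 2 ^ j - 2 ^ k = (0 :: int) then 2 * pi else 0)))
     {0..2 * pi}"
    by (intro has_integral_sum has_integral_mult_right has_integral_cos_int) auto
  also have "(\<Sum>j<N. \<Sum>k<N. r ^ 2 ^ j * r ^ 2 ^ k * (if 2 ^ j - 2 ^ k = (0 :: int) then 2 * pi else 0))
      = (\<Sum>j<N. \<Sum>k<N. if k = j then r ^ 2 ^ j * r ^ 2 ^ j * (2 * pi) else 0)"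
    by (intro sum.cong refl) auto
  also have "\<dots> = 2 * pi * (\<Sum>k<N. (r ^ 2 ^ k)\<^sup>2)"
    by (simp add: sum.delta sum_distrib_left power2_eq_square mult_ac)
  finally show ?thesis by (simp add: norm_sq_lacunary_poly)
qed

lemma nn_integral_norm_sq_lacunary_poly:
  "(\<integral>\<^sup>+ t \<in> {0..<2 * pi}. ennreal ((norm (lacunary_poly N (of_real r * cis t)))\<^sup>2) \<partial>lborel)
    = ennreal (2 * pi * (\<Sum>k<N. (r ^ 2 ^ k)\<^sup>2))"
proof -
  have "((\<lambda>t. (norm (lacunary_poly N (of_real r * cis t)))\<^sup>2) has_integral
      2 * pi * (\<Sum>k<N. (r ^ 2 ^ k)\<^sup>2)) {0..<2 * pi}"
    by (subst has_integral_spike_set_eq[of _ "{0..2 * pi}"])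
       (auto intro: negligible_subset[of "{2 * pi}"] has_integral_norm_sq_lacunary_poly)
  from nn_integral_has_integral_lebesgue[OF _ this] show ?thesis
    by (simp add: ennreal_mult' ennreal_indicator mult.commute)
qed

text \<open>
  A form of Jensen's inequality with the constant \<open>2 powr (- q)\<close> lost. It integrates the elementary
  bound \<open>A powr (q - 1) * y \<le> y powr q + A powr q\<close>, in which \<open>A\<close> is half of the lower bound for the
  mean, so that the subtracted term costs only half of what the left-hand side provides.
\<close>

lemma mean_powr_le_nn_integral_powr:
  fixes u :: "'a \<Rightarrow> real" and q A :: real
  assumes q: "1 < q" and A: "0 < A" and u: "\<And>x. 0 \<le> u x" "u \<in> borel_measurable M"
    and fin: "emeasure M (space M) = ennreal c" and c: "0 \<le> c"
    and mean: "(\<integral>\<^sup>+ x. ennreal (u x) \<partial>M) \<ge> ennreal (2 * A * c)"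
  shows "ennreal (A powr q * c) \<le> (\<integral>\<^sup>+ x. ennreal (u x powr q) \<partial>M)"
proof -
  have pt: "A powr (q - 1) * y \<le> y powr q + A powr q" if "0 \<le> y" for y
  proof (cases "A \<le> y")
    case True
    have "A powr (q - 1) * y \<le> y powr (q - 1) * y"
      using True A q that by (intro mult_right_mono powr_mono2) auto
    also have "\<dots> = y powr q" using True A by (simp add: powr_diff)
    finally show ?thesis by (simp add: add_increasing2)
  next
    case False
    have "A powr (q - 1) * y \<le> A powr (q - 1) * A"
      using False by (intro mult_left_mono) auto
    also have "\<dots> = A powr q" using A by (simp add: powr_diff)
    finally show ?thesis by (simp add: add_increasing)
  qed
  have [measurable]: "u \<in> borel_measurable M" by fact
  have "ennreal (A powr q * c) + ennreal (A powr q * c) = ennreal (A powr (q - 1)) * ennreal (2 * A * c)"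
    using A c by (simp add: ennreal_mult[symmetric] ennreal_plus[symmetric] powr_diff del: ennreal_plus)
  also have "\<dots> \<le> ennreal (A powr (q - 1)) * (\<integral>\<^sup>+ x. ennreal (u x) \<partial>M)"
    using mean by (rule mult_left_mono) simp
  also have "\<dots> = (\<integral>\<^sup>+ x. ennreal (A powr (q - 1) * u x) \<partial>M)"
    using u by (subst nn_integral_cmult[symmetric]) (auto simp: ennreal_mult)
  also have "\<dots> \<le> (\<integral>\<^sup>+ x. ennreal (u x powr q) + ennreal (A powr q) \<partial>M)"
    by (intro nn_integral_mono) (use pt u in \<open>auto simp: ennreal_plus[symmetric] simp del: ennreal_plus intro!: ennreal_leI\<close>)
  also have "\<dots> = (\<integral>\<^sup>+ x. ennreal (u x powr q) \<partial>M) + ennreal (A powr q * c)"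
    using c by (subst nn_integral_add) (auto simp: fin ennreal_mult)
  finally show ?thesis
    by (simp add: ennreal_add_left_cancel_le add.commute)
qed

text \<open>
  For \<open>k < N \<le> n\<close> the monomial \<open>z ^ 2 ^ k\<close> has not yet decayed on the \<open>n\<close>-th circle: with
  \<open>x = 2 ^ (-n-1) \<le> 1/2\<close> one has \<open>1 - x \<ge> exp (- 2 * x)\<close>, and the total exponent \<open>2 ^ (k + 1)\<close> is at
  most \<open>2 ^ n\<close>.
\<close>

lemma dyadic_radius_power_ge:
  assumes "k < N" "N \<le> n"
  shows "exp (-1) \<le> ((1 - (1/2) ^ Suc n :: real) ^ 2 ^ k)\<^sup>2"
proof -
  define x :: real where "x = (1/2) ^ Suc n"
  have x: "0 < x" "x \<le> 1/2" by (auto simp: x_def power_le_one)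
  have "- x - 2 * x\<^sup>2 \<le> ln (1 - x)"
    using x by (intro ln_one_minus_pos_lower_bound) auto
  moreover have "2 * x\<^sup>2 \<le> x" using x by (simp add: power2_eq_square)
  ultimately have ln: "- (2 * x) \<le> ln (1 - x)" by simp
  have "(2::real) ^ Suc k \<le> 2 ^ n" using assms by (intro power_increasing) auto
  hence "2 ^ Suc k * (2 * x) \<le> 2 ^ n * (2 * x)" using x by (intro mult_right_mono) auto
  also have "\<dots> = 1" by (simp add: x_def power_one_over)
  finally have "-1 \<le> 2 ^ Suc k * (- (2 * x))" by simp
  also have "\<dots> \<le> 2 ^ Suc k * ln (1 - x)" using ln by (intro mult_left_mono) auto
  also have "\<dots> = ln ((1 - x) ^ 2 ^ Suc k)" using x by (simp add: ln_realpow)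
  finally have "exp (-1) \<le> exp (ln ((1 - x) ^ 2 ^ Suc k))" by simp
  also have "\<dots> = (1 - x) ^ 2 ^ Suc k" using x by (intro exp_ln) simp
  also have "\<dots> = ((1 - x) ^ 2 ^ k)\<^sup>2" by (simp add: power_mult[symmetric] mult.commute)
  finally show ?thesis by (simp add: x_def)
qed

lemma nn_integral_lacunary_poly_circle_ge:
  fixes p :: real
  assumes p: "2 < p" and N: "0 < N" "N \<le> n"
  shows "ennreal ((exp (-1) / 2 * N) powr (p / 2) * (2 * pi)) \<le>
    (\<integral>\<^sup>+ t \<in> {0..<2 * pi}.
       ennreal (norm (lacunary_poly N (of_real (1 - (1/2) ^ Suc n) * cis t)) powr p) \<partial>lborel)"
proof -
  let ?T = "restrict_space lborel {0..<2 * pi :: real}"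
  define r :: real where "r = 1 - (1/2) ^ Suc n"
  let ?u = "\<lambda>t. (norm (lacunary_poly N (of_real r * cis t)))\<^sup>2"
  have "?u \<in> borel_measurable borel"
    unfolding lacunary_poly_def by (intro borel_measurable_continuous_onI continuous_intros)
  hence u: "?u \<in> borel_measurable ?T" by (simp add: measurable_restrict_space1)
  have "(\<Sum>k<N. exp (-1)) \<le> (\<Sum>k<N. (r ^ 2 ^ k)\<^sup>2)"
    unfolding r_def using N by (intro sum_mono dyadic_radius_power_ge) auto
  hence "2 * (exp (-1) / 2 * N) * (2 * pi) \<le> 2 * pi * (\<Sum>k<N. (r ^ 2 ^ k)\<^sup>2)"
    by (simp add: mult_ac)
  hence mean: "ennreal (2 * (exp (-1) / 2 * N) * (2 * pi)) \<le> (\<integral>\<^sup>+ t. ennreal (?u t) \<partial>?T)"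
    using nn_integral_norm_sq_lacunary_poly[of N r]
    by (simp add: nn_integral_restrict_space ennreal_leI)
  have "ennreal ((exp (-1) / 2 * N) powr (p / 2) * (2 * pi)) \<le> (\<integral>\<^sup>+ t. ennreal (?u t powr (p / 2)) \<partial>?T)"
    by (rule mean_powr_le_nn_integral_powr[OF _ _ _ u _ _ mean])
       (use p N in \<open>auto simp: emeasure_restrict_space space_restrict_space\<close>)
  also have "\<dots> = (\<integral>\<^sup>+ t. ennreal (norm (lacunary_poly N (of_real r * cis t)) powr p) \<partial>?T)"
    by (intro nn_integral_cong)
       (auto simp: powr_numeral[symmetric] powr_powr simp del: powr_numeral)
  finally show ?thesis by (simp add: nn_integral_restrict_space r_def)
qed

section \<open>Failure of the Carleson embedding\<close>

lemma nn_integral_lacunary_poly_circles_measure_ge: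
  fixes p :: real and G :: "nat \<Rightarrow> real"
  assumes p: "2 < p" and N: "0 < N" and G: "decseq G" "G \<longlonglongrightarrow> 0"
  shows "ennreal (G N * ((exp (-1) / 2 * N) powr (p / 2) * (2 * pi))) \<le>
    (\<integral>\<^sup>+ z. ennreal (norm (lacunary_poly N z) powr p)
      \<partial>circles_measure (\<lambda>n. 1 - (1/2) ^ Suc n) (\<lambda>n. G n - G (Suc n)))"
proof -
  let ?c = "(exp (-1) / 2 * N) powr (p / 2) * (2 * pi)"
  let ?J = "\<lambda>n. \<integral>\<^sup>+ t \<in> {0..<2 * pi}.
       ennreal (norm (lacunary_poly N (of_real (1 - (1/2) ^ Suc n) * cis t)) powr p) \<partial>lborel"
  have "G N \<ge> 0" using G by (rule decseq_ge)
  have "lacunary_poly N \<in> borel_measurable borel"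
    unfolding lacunary_poly_def by (intro borel_measurable_continuous_onI continuous_intros)
  hence meas: "(\<lambda>z. ennreal (norm (lacunary_poly N z) powr p))
      \<in> borel_measurable (restrict_space borel (ball 0 1))"
    by (intro measurable_restrict_space1) measurable
  have "ennreal (G N * ?c) = (\<Sum>n. ennreal (G n - G (Suc n)) * indicator {N..} n) * ennreal ?c"
    using \<open>G N \<ge> 0\<close> by (simp only: tail_weights_suminf[OF G]) (simp add: ennreal_mult)
  also have "\<dots> = (\<Sum>n. ennreal (G n - G (Suc n)) * indicator {N..} n * ennreal ?c)"
    by simp
  also have "\<dots> \<le> (\<Sum>n. ennreal (G n - G (Suc n)) * ?J n)"
  proof (intro suminf_le allI)
    fix n
    show "ennreal (G n - G (Suc n)) * indicator {N..} n * ennreal ?c \<le> ennreal (G n - G (Suc n)) * ?J n"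
    proof (cases "N \<le> n")
      case True
      with nn_integral_lacunary_poly_circle_ge[OF p N True] show ?thesis
        by (simp add: mult_left_mono)
    qed simp
  qed auto
  also have "\<dots> = (\<integral>\<^sup>+ z. ennreal (norm (lacunary_poly N z) powr p)
      \<partial>circles_measure (\<lambda>n. 1 - (1/2) ^ Suc n) (\<lambda>n. G n - G (Suc n)))"
    by (rule nn_integral_circles_measure[symmetric])
       (use meas in \<open>auto simp: power_Suc_less_one simp del: power_Suc\<close>)
  finally show ?thesis .
qed

text \<open>
  Testing on the \<open>N\<close>-th lacunary polynomial, the embedding would force
  \<open>G N * N powr (p/2) \<lesssim> N + 1\<close>.
\<close>

lemma not_carleson_measure_circles_measure:
  fixes p :: real and G :: "nat \<Rightarrow> real"
  assumes p: "2 < p" and G: "decseq G" "G \<longlonglongrightarrow> 0"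
    and large: "filterlim (\<lambda>n. G n * (real n + 2) powr (p / 2 - 1)) at_top sequentially"
  shows "\<not> carleson_measure p (circles_measure (\<lambda>n. 1 - (1/2) ^ Suc n) (\<lambda>n. G n - G (Suc n)))"
proof
  let ?\<mu> = "circles_measure (\<lambda>n. 1 - (1/2) ^ Suc n) (\<lambda>n. G n - G (Suc n))"
  assume "carleson_measure p ?\<mu>"
  then obtain C where C: "C > 0" and carleson: "\<And>f. f \<in> dirichlet_space p \<Longrightarrow>
      (\<integral>\<^sup>+ z. ennreal (norm (f z) powr p) \<partial>?\<mu>) \<le> ennreal C * dirichlet_norm_powr p f"
    unfolding carleson_measure_def by blast
  define K where "K = 2 * 2 powr (3 * p)"
  define c where "c = (exp (-1) / 6) powr (p / 2) * (2 * pi)"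
  have pos: "K > 0" "c > 0" by (auto simp: K_def c_def)
  have bound: "G N * (real N + 2) powr (p / 2 - 1) \<le> C * K / c" if "0 < N" for N
  proof -
    have G0: "G N \<ge> 0" using G by (rule decseq_ge)
    have norm: "dirichlet_norm_powr p (lacunary_poly N) \<le> ennreal (K * (N + 1))"
      unfolding K_def using p by (intro dirichlet_norm_powr_lacunary_poly_le) simp
    hence "lacunary_poly N \<in> dirichlet_space p"
      using order.strict_trans1[OF norm, of \<infinity>]
      by (simp add: dirichlet_space_def lacunary_poly_holomorphic)
    from carleson[OF this] have "(\<integral>\<^sup>+ z. ennreal (norm (lacunary_poly N z) powr p) \<partial>?\<mu>)
        \<le> ennreal C * ennreal (K * (N + 1))"
      using norm by (meson mult_left_mono order.trans zero_le)
    also have "\<dots> = ennreal (C * (K * (N + 1)))"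
      using C pos by (simp add: ennreal_mult)
    finally have "ennreal (G N * ((exp (-1) / 2 * N) powr (p / 2) * (2 * pi))) \<le> ennreal (C * (K * (N + 1)))"
      using nn_integral_lacunary_poly_circles_measure_ge[OF p that G] by (rule order.trans[rotated])
    hence le: "G N * ((exp (-1) / 2 * N) powr (p / 2) * (2 * pi)) \<le> C * (K * (N + 1))"
      using C pos by (subst (asm) ennreal_le_iff) auto
    \<comment> \<open>The constant \<open>6\<close> in \<open>c\<close> absorbs \<open>N + 2 \<le> 3 * N\<close>.\<close>
    have "G N * (real N + 2) powr (p / 2 - 1) * c * (real N + 2)
        = G N * (real N + 2) powr (p / 2 - 1) * (real N + 2) * c"
      by (simp only: mult_ac)
    also have "\<dots> = G N * ((exp (-1) / 6 * (real N + 2)) powr (p / 2) * (2 * pi))"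
    proof -
      have "(real N + 2) powr (p / 2 - 1) * (real N + 2) = (real N + 2) powr (p / 2)"
        by (simp add: powr_diff)
      moreover have "(exp (-1) / 6 * (real N + 2)) powr (p / 2)
          = (exp (-1) / 6) powr (p / 2) * (real N + 2) powr (p / 2)"
        by (rule powr_mult)
      ultimately show ?thesis by (simp only: c_def mult_ac)
    qed
    also have "\<dots> \<le> G N * ((exp (-1) / 2 * N) powr (p / 2) * (2 * pi))"
      using that p G0 by (intro mult_left_mono mult_right_mono powr_mono2) (auto simp: field_simps)
    also note le
    also have "C * (K * (N + 1)) \<le> C * K * (real N + 2)"
      using C pos by (simp add: algebra_simps)
    finally have "G N * (real N + 2) powr (p / 2 - 1) * c * (real N + 2) \<le> C * K * (real N + 2)" .
    hence "G N * (real N + 2) powr (p / 2 - 1) * c \<le> C * K"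
      by (rule mult_right_le_imp_le) simp
    with pos(2) show ?thesis
      by (simp only: pos_le_divide_eq)
  qed
  from large have "eventually (\<lambda>n. C * K / c + 1 \<le> G n * (real n + 2) powr (p / 2 - 1)) sequentially"
    by (simp add: filterlim_at_top)
  then obtain M where M: "\<And>n. n \<ge> M \<Longrightarrow> C * K / c + 1 \<le> G n * (real n + 2) powr (p / 2 - 1)"
    unfolding eventually_sequentially by blast
  have "C * K / c + 1 \<le> G (Suc M) * (real (Suc M) + 2) powr (p / 2 - 1)"
    by (rule M) simp
  also have "\<dots> \<le> C * K / c" by (rule bound) simp
  finally show False by simp
qed

section \<open>Dyadic discretisation of the gauge\<close>

lemma ln_exp_1_div_le:
  fixes a :: real
  assumes "(1/2) ^ n \<le> a" "a \<le> 1"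
  shows "1 \<le> ln (exp 1 / a)" "ln (exp 1 / a) \<le> 1 + real n"
proof -
  have a: "0 < a" using assms(1) by (rule order.strict_trans2[rotated]) simp
  have eq: "ln (exp 1 / a) = 1 - ln a" using a by (simp add: ln_div)
  show "1 \<le> ln (exp 1 / a)" using a assms by (simp add: eq)
  have "- (real n * ln 2) = ln ((1/2) ^ n)" by (simp add: ln_realpow ln_div)
  also have "\<dots> \<le> ln a" using assms a by (subst ln_le_cancel_iff) auto
  finally have "- ln a \<le> real n * ln 2" by simp
  also have "\<dots> \<le> real n * 1" using ln_2_less_1 by (intro mult_left_mono) auto
  finally show "ln (exp 1 / a) \<le> 1 + real n" by (simp add: eq)
qed

text \<open>
  Here \<open>N\<close> is the first index with \<open>2 ^ (-N-1) \<le> a\<close>. Then \<open>a \<le> 2 ^ (-N)\<close> as well, so replacing \<open>a\<close>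
  by \<open>2 ^ (-N)\<close> decreases \<open>\<Phi>\<close>, while \<open>ln (e / a) \<le> N + 2\<close>; the offset \<open>2\<close> makes the comparison hold
  with constant \<open>1\<close>.
\<close>

lemma dyadic_gauge_le:
  fixes s a :: real and \<Phi> :: "real \<Rightarrow> real"
  assumes s: "0 < s" and a: "0 < a" "a \<le> 1"
    and pos: "\<And>r. r \<in> {0..<1} \<Longrightarrow> 0 < \<Phi> r" and incr: "mono_on {0..<1} \<Phi>"
  obtains N where "{n. 1 - a \<le> 1 - (1/2) ^ Suc n} \<subseteq> {N..}"
    "(real N + 2) powr (- s) * \<Phi> (1 - (1/2) ^ N) \<le> ln (exp 1 / a) powr (- s) * \<Phi> (1 - a)"
proof -
  define N where "N = (LEAST n. (1/2) ^ Suc n \<le> a)"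
  obtain k where "(1/2 :: real) ^ k < a"
    using real_arch_pow_inv[of a "1/2"] a by auto
  hence "(1/2) ^ Suc k \<le> a"
    using zero_le_power[of "1/2 :: real" k] unfolding power_Suc by linarith
  hence N: "(1/2) ^ Suc N \<le> a" unfolding N_def by (rule LeastI)
  have upper: "a \<le> (1/2) ^ N"
  proof (cases N)
    case (Suc M)
    hence "\<not> (1/2) ^ Suc M \<le> a" using not_less_Least[of M "\<lambda>n. (1/2) ^ Suc n \<le> a"] N_def by auto
    thus ?thesis using Suc by simp
  qed (use a in auto)
  have ln: "1 \<le> ln (exp 1 / a)" "ln (exp 1 / a) \<le> real N + 2"
    using ln_exp_1_div_le[OF N a(2)] by auto
  show thesis
  proof
    show "{n. 1 - a \<le> 1 - (1/2) ^ Suc n} \<subseteq> {N..}"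
      unfolding N_def by (auto intro: Least_le)
    have "(real N + 2) powr (- s) \<le> ln (exp 1 / a) powr (- s)"
      using ln s by (intro powr_mono2') auto
    moreover have "\<Phi> (1 - (1/2) ^ N) \<le> \<Phi> (1 - a)"
      by (rule mono_onD[OF incr]) (use upper a in \<open>auto simp: power_le_one\<close>)
    moreover have "0 < \<Phi> (1 - (1/2) ^ N)" by (rule pos) (auto simp: power_le_one)
    ultimately show "(real N + 2) powr (- s) * \<Phi> (1 - (1/2) ^ N) \<le> ln (exp 1 / a) powr (- s) * \<Phi> (1 - a)"
      by (intro mult_mono) auto
  qed
qed

lemma filterlim_dyadic_radius_at_left:
  "filterlim (\<lambda>n. 1 - (1/2) ^ n :: real) (at_left 1) sequentially"
proof -
  have "(\<lambda>n. 1 - (1/2) ^ n :: real) \<longlonglongrightarrow> 1 - 0"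
    by (intro tendsto_intros LIMSEQ_power_zero) auto
  thus ?thesis by (auto simp: filterlim_at)
qed

lemma filterlim_mono_unbounded_at_left:
  fixes \<Phi> :: "real \<Rightarrow> real"
  assumes incr: "mono_on {0..<1} \<Phi>" and unbdd: "\<not> bdd_above (\<Phi> ` {0..<1})"
  shows "filterlim \<Phi> at_top (at_left 1)"
  unfolding filterlim_at_top
proof
  fix Z :: real
  have "\<exists>r\<in>{0..<1}. Z < \<Phi> r"
    using unbdd by (simp add: bdd_above_def not_le)
  then obtain r where r: "0 \<le> r" "r < 1" "Z < \<Phi> r" by auto
  have "eventually (\<lambda>x. x \<in> {r<..<1}) (at_left 1)"
    using r by (intro eventually_at_left_real)
  thus "eventually (\<lambda>x. Z \<le> \<Phi> x) (at_left 1)"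
  proof eventually_elim
    case (elim x)
    have "\<Phi> r \<le> \<Phi> x" by (rule mono_onD[OF incr]) (use elim r in auto)
    with r show ?case by simp
  qed
qed

section \<open>The counterexample\<close>

theorem proposition12:
  fixes p :: real and \<Phi> \<Phi>' :: "real \<Rightarrow> real" and m :: ereal
  assumes p: "2 < p"
    and range: "\<And>r. r \<in> {0..<1} \<Longrightarrow> 1 < \<Phi> r"
    and deriv: "\<And>r. r \<in> {0..<1} \<Longrightarrow> (\<Phi> has_real_derivative \<Phi>' r) (at r within {0..<1})"
    and incr: "mono_on {0..<1} \<Phi>"
    and unbdd: "\<not> bdd_above (\<Phi> ` {0..<1})"
    and decr: "antimono_on {0..<1} (\<lambda>r. \<Phi>' r / \<Phi> r * (1 - r))"
    and lim: "((\<lambda>r. \<Phi> r / (ln (exp 1 / (1 - r))) powr (p / 2 - 1)) \<longlongrightarrow> 0) (at_left 1)"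
    and m_eq: "m = - Liminf (at_left 1) (\<lambda>r. ereal (\<Phi>' r / \<Phi> r * (1 - r) * ln (exp 1 / (1 - r))))"
    and m_gt: "m > ereal (1 - p / 2)"
  shows "\<exists>\<mu> :: complex measure. borel_measure_on_disc \<mu> \<and>
           (SUP I \<in> circle_arcs. emeasure \<mu> (carleson_square I) /
              ennreal (arc_measure I * (ln (exp 1 / arc_measure I)) powr (- p / 2 + 1)
                       * \<Phi> (1 - arc_measure I))) < \<infinity> \<and>
           \<not> carleson_measure p \<mu>"
proof -
  define s where "s = p / 2 - 1"
  have s: "0 < s" using p by (simp add: s_def)
  define \<phi> where "\<phi> n = \<Phi> (1 - (1/2) ^ n)" for n
  have \<phi>: "0 < \<phi> n" for n
    unfolding \<phi>_def by (rule less_trans[OF zero_less_one range]) (auto simp: power_le_one)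
  define b where "b n = (real n + 2) powr s" for n :: nat
  define g where "g n = (real n + 2) powr (- s) * \<phi> n" for n :: nat
  have gb: "g n * b n = \<phi> n" for n by (simp add: g_def b_def powr_minus)
  have g_lim: "g \<longlonglongrightarrow> 0"
  proof (rule tendsto_sandwich[OF _ _ tendsto_const])
    show "(\<lambda>n. \<phi> n / ln (exp 1 / (1 / 2) ^ n) powr s) \<longlonglongrightarrow> 0"
      using filterlim_compose[OF lim filterlim_dyadic_radius_at_left] by (simp add: \<phi>_def s_def)
    have "g n \<le> \<phi> n / ln (exp 1 / (1 / 2) ^ n) powr s" for n
    proof -
      have ln: "1 \<le> ln (exp 1 / (1/2 :: real) ^ n)" "ln (exp 1 / (1/2 :: real) ^ n) \<le> 1 + real n"
        using ln_exp_1_div_le[of n "(1/2) ^ n"] by (simp_all add: power_le_one)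
      have "(real n + 2) powr (- s) \<le> ln (exp 1 / (1/2) ^ n) powr (- s)"
        by (rule powr_mono2') (use ln s in linarith)+
      hence "g n \<le> ln (exp 1 / (1/2) ^ n) powr (- s) * \<phi> n"
        unfolding g_def by (rule mult_right_mono) (rule less_imp_le[OF \<phi>])
      also have "\<dots> = \<phi> n / ln (exp 1 / (1/2) ^ n) powr s"
        by (simp only: powr_minus_divide times_divide_eq_left mult_1)
      finally show ?thesis .
    qed
    thus "eventually (\<lambda>n. g n \<le> \<phi> n / ln (exp 1 / (1 / 2) ^ n) powr s) sequentially"
      by simp
  qed (use \<phi> in \<open>auto simp: g_def intro!: always_eventually less_imp_le\<close>)
  have "filterlim b at_top sequentially"
    unfolding b_def using s by real_asymp
  moreover have "incseq b" unfolding b_def incseq_def using s by (auto intro!: powr_mono2)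
  moreover have "filterlim (\<lambda>n. g n * b n) at_top sequentially"
    unfolding gb unfolding \<phi>_def
    by (rule filterlim_compose[OF filterlim_mono_unbounded_at_left[OF incr unbdd]
          filterlim_dyadic_radius_at_left])
  ultimately obtain G where G: "decseq G" "\<And>n. 0 < G n" "\<And>n. G n \<le> g n" "G \<longlonglongrightarrow> 0"
      "filterlim (\<lambda>n. G n * b n) at_top sequentially"
    using decreasing_minorant[of g b] g_lim \<phi> by (auto simp: g_def b_def)
  define \<mu> where "\<mu> = circles_measure (\<lambda>n. 1 - (1/2) ^ Suc n) (\<lambda>n. G n - G (Suc n))"
  have ratio: "emeasure \<mu> (carleson_square I) / ennreal (arc_measure I *
      (ln (exp 1 / arc_measure I)) powr (- p / 2 + 1) * \<Phi> (1 - arc_measure I)) \<le> ennreal (2 * pi)" for I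
  proof (cases "0 < arc_measure I")
    case False
    \<comment> \<open>The radii would have to satisfy \<open>1 \<le> r < 1\<close>.\<close>
    hence "carleson_square I = {}" by (auto simp: carleson_square_def)
    thus ?thesis by simp
  next
    case True
    define a where "a = arc_measure I"
    have a: "0 < a" "a \<le> 1" using True arc_measure_le_1 by (auto simp: a_def)
    have \<Phi>: "0 < \<Phi> r" if "r \<in> {0..<1}" for r using range[OF that] by simp
    obtain N where N: "{n. 1 - a \<le> 1 - (1/2) ^ Suc n} \<subseteq> {N..}"
      "g N \<le> ln (exp 1 / a) powr (- s) * \<Phi> (1 - a)"
      using dyadic_gauge_le[OF s a \<Phi> incr] unfolding g_def \<phi>_def by blast
    define l where "l = ln (exp 1 / a)"
    have "ln a \<le> 0" using a by simp
    moreover have "l = 1 - ln a" using a by (simp add: l_def ln_div)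
    ultimately have l: "0 < l" by linarith
    let ?d = "a * l powr (- p / 2 + 1) * \<Phi> (1 - a)"
    have d: "0 < ?d" using a l \<Phi>[of "1 - a"] by simp
    have exponent: "- p / 2 + 1 = - s" by (simp add: s_def)
    have "emeasure \<mu> (carleson_square I)
       \<le> (\<Sum>n. ennreal (G n - G (Suc n)) * indicator {n. 1 - a \<le> 1 - (1/2) ^ Suc n} n)
            * ennreal (2 * pi * a)"
      unfolding \<mu>_def a_def
      by (rule emeasure_circles_measure_carleson_square_le)
         (auto simp: power_Suc_less_one simp del: power_Suc)
    also have "\<dots> \<le> (\<Sum>n. ennreal (G n - G (Suc n)) * indicator {N..} n) * ennreal (2 * pi * a)"
      using N(1) by (intro mult_right_mono suminf_le allI mult_left_mono)
         (auto split: split_indicator)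
    also have "\<dots> = ennreal (G N * (2 * pi * a))"
      using G(2)[of N] a by (simp only: tail_weights_suminf[OF G(1,4)]) (simp add: ennreal_mult)
    also have "\<dots> \<le> ennreal (l powr (- s) * \<Phi> (1 - a) * (2 * pi * a))"
      using order.trans[OF G(3) N(2)] a unfolding l_def by (intro ennreal_leI mult_right_mono) auto
    also have "\<dots> = ennreal (?d * (2 * pi))"
      unfolding exponent by (simp only: mult_ac)
    also have "\<dots> = ennreal ?d * ennreal (2 * pi)"
      using d by (intro ennreal_mult) auto
    finally show ?thesis
      using d unfolding a_def[symmetric] l_def[symmetric]
      by (intro divide_le_posI_ennreal) (simp_all only: ennreal_less_zero_iff)
  qed
  have "(SUP I \<in> circle_arcs. emeasure \<mu> (carleson_square I) / ennreal (arc_measure I *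
      (ln (exp 1 / arc_measure I)) powr (- p / 2 + 1) * \<Phi> (1 - arc_measure I))) \<le> ennreal (2 * pi)"
    using ratio by (intro SUP_least)
  also have "\<dots> < \<infinity>" by simp
  finally have "(SUP I \<in> circle_arcs. emeasure \<mu> (carleson_square I) / ennreal (arc_measure I *
      (ln (exp 1 / arc_measure I)) powr (- p / 2 + 1) * \<Phi> (1 - arc_measure I))) < \<infinity>" .
  moreover have "\<not> carleson_measure p \<mu>"
    unfolding \<mu>_def using G(5) unfolding b_def s_def
    by (intro not_carleson_measure_circles_measure p G)
  moreover have "borel_measure_on_disc \<mu>"
    unfolding \<mu>_def by (rule borel_measure_on_disc_circles_measure)
  ultimately show ?thesis by (intro exI[of _ \<mu>] conjI)
qed

end
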